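(* Let $n,m,l,T\ge 1$, let $\phi:\mathbb{R}^n\to\mathbb{R}^l$ be a vector of monomials, let $G\in\mathbb{R}^{n\times m}$, $\epsilon\ge 0$, and let data $\{\dot x[i],x[i],u[i]\}_{i=1}^T$ with $\dot x[i],x[i]\in\mathbb{R}^n$, $u[i]\in\mathbb{R}^m$ be given. Let $\mathcal{P}_1\subset\mathbb{R}^{n\times l}$, $\Phi_{i,k}^{\pm}$ and $d_{i,k}^{\pm}$ be as defined in the context, and let $\lambda>0$. Let $W\in C^1(\mathbb{R}^n,S_n^{++})$ and $\rho:\mathbb{R}^n\to\mathbb{R}$. Say that $(W,\rho)$ solves the robust contraction problem (with rate $\lambda$) if $\partial_G W(x)=0$ for all $x\in\mathbb{R}^n$ and, for every $F\in\mathcal{P}_1$ and every $x\in\mathbb{R}^n$, $$-\dot W(x)+W(x)\Big(F\frac{\partial\phi}{\partial x}(x)\Big)^{\top}+\Big(F\frac{\partial\phi}{\partial x}(x)\Big)W(x)+2\lambda W(x)-\rho(x)GG^{\top}\prec 0,$$ where $\dot W(x)=\sum_{j=1}^n\frac{\partial W}{\partial x_j}(x)\,(F\phi(x))_j$. Then $(W,\rho)$ solves the robust contraction problem if there exist functions $\mu_{i,k}^{\pm}(x,y)$ ($i=1,\dots,T$, $k=1,\dots,n$), defined for $x\in\mathbb{R}^n$ and $y\in\mathbb{R}^n$ with $\|y\|_2=1$, such that for all $x\in\mathbb{R}^n$ and all $y\in\mathbb{R}^n$ with $\|y\|_2=1$ (arguments $x$ and $(x,y)$ omitted): (a) $\displaystyle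 y^{\top}\big(-2\lambda W+\rho GG^{\top}\big)y-\sum_{i,k,\pm}\mu_{i,k}^{\pm}d_{i,k}^{\pm}>0$; (b) $\displaystyle \mathrm{vec}\Big(-2\frac{\partial\phi}{\partial x}Wyy^{\top}+\sum_{i,k,\pm}\mu_{i,k}^{\pm}\Phi_{i,k}^{\pm}\Big)^{\top}+\sum_{j=1}^n\mathrm{Tr}\Big(\frac{\partial W}{\partial x_j}yy^{\top}\Big)\big(e_j^{\top}\otimes\phi^{\top}\big)=0$; (c) $\partial_G W(x)=0$; (d) $\mu_{i,k}^{\pm}(x,y)\ge 0$ for all $i,k,\pm$, and $W(x)\succ 0$. Moreover, if $\mathcal{P}_1$ has non-empty interior, then this condition is also necessary: if $(W,\rho)$ solves the robust contraction problem, then functions $\mu_{i,k}^{\pm}$ satisfying (a)–(d) exist.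
   Context: The underlying control system is $\dot x=F\phi(x)+Gu$ with state $x\in\mathbb{R}^n$, input $u\in\mathbb{R}^m$, unknown $F\in\mathbb{R}^{n\times l}$ and known constant $G$. $S_n^{++}$ is the set of symmetric positive definite $n\times n$ real matrices; $A\prec0$ and $A\succ 0$ mean negative and positive definite. $\frac{\partial\phi}{\partial x}$ is the $l\times n$ Jacobian of $\phi$. $\mathrm{vec}$ stacks the columns of a matrix, $\otimes$ is the Kronecker product, $e_j$ is the $j$-th standard basis vector of $\mathbb{R}^n$ in condition (b), and $(v)_k$ is the $k$-th entry of a vector $v$. Consistency set: $\mathcal{P}_1=\{F\in\mathbb{R}^{n\times l}:\ \|F\phi(x[i])+Gu[i]-\dot x[i]\|_\infty\le\epsilon,\ i=1,\dots,T\}$. Equivalently, $\mathcal{P}_1=\{F:\ \mathrm{Tr}(F\Phi_{i,k}^{\pm})\le d_{i,k}^{\pm}\ \text{for all } i=1,\dots,T,\ k=1,\dots,n \text{ and both signs}\}$, where $\Phi_{i,k}^{\pm}\in\mathbb{R}^{l\times n}$ is the matrix whose $k$-th column is $\pm\phi(x[i])$ and whose other columns are zero, and $d_{i,k}^{\pm}=\epsilon\pm(\dot x[i]-Gu[i])_k$. Sums over $i,k,\pm$ run over all $2nT$ triples. The condition $\partial_G W(x)=0$ means $\sum_{j=1}^n\frac{\partial W(x)}{\partial x_j}\,(G\hat e_i)_j=0$ for every $i=1,\dots,m$, where $\hat e_i$ is the $i$-th standard basis vector of $\mathbb{R}^m$. Under this condition the derivative of $W$ along the dynamics, $\sum_j\frac{\partial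 W}{\partial x_j}(F\phi+Gu)_j$, does not depend on $u$ and equals $\sum_j\frac{\partial W}{\partial x_j}(F\phi)_j$. *)

theory Defs
  imports "HOL-Analysis.Analysis"
begin

text \<open>The matrix space of \<open>p \<times> q\<close> matrices is \<^typ>\<open>real^'q^'p\<close>, rows being indexed by
  \<^typ>\<open>'p\<close>.\<close>

definition pos_def :: "real^'n^'n \<Rightarrow> bool" where
  "pos_def A \<longleftrightarrow> transpose A = A \<and> (\<forall>v. v \<noteq> 0 \<longrightarrow> v \<bullet> (A *v v) > 0)"

definition neg_def :: "real^'n^'n \<Rightarrow> bool" where
  "neg_def A \<longleftrightarrow> transpose A = A \<and> (\<forall>v. v \<noteq> 0 \<longrightarrow> v \<bullet> (A *v v) < 0)"

definition C1 :: "('a::real_normed_vector \<Rightarrow> 'b::real_normed_vector) \<Rightarrow> bool" where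
  "C1 f \<longleftrightarrow> (\<exists>f' :: 'a \<Rightarrow> ('a \<Rightarrow>\<^sub>L 'b).
     (\<forall>x. (f has_derivative blinfun_apply (f' x)) (at x)) \<and> continuous_on UNIV f')"

definition partial_deriv ::
    "'n \<Rightarrow> (real^'n \<Rightarrow> 'b::real_normed_vector) \<Rightarrow> real^'n \<Rightarrow> 'b" where
  "partial_deriv j f x = vector_derivative (\<lambda>t. f (x + t *\<^sub>R axis j 1)) (at 0)"

text \<open>Monomials are monic; the constant monomial 1 is allowed.\<close>

definition is_monomial :: "(real^'n \<Rightarrow> real) \<Rightarrow> bool" where
  "is_monomial p \<longleftrightarrow> (\<exists>\<alpha> :: 'n \<Rightarrow> nat. \<forall>x. p x = (\<Prod>j\<in>UNIV. (x $ j) ^ \<alpha> j))"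

text \<open>The entries of \<open>vec\<close> of a \<open>p \<times> q\<close> matrix are indexed by (column, row), i.e. the first
  component selects the block (a column of the matrix) and the second the position within the
  block. The Kronecker product uses the same block indexing for its columns and rows.\<close>

definition vec_cols :: "real^'q^'p \<Rightarrow> real^('q \<times> 'p)" where
  "vec_cols A = (\<chi> ja. A $ snd ja $ fst ja)"

definition kronecker :: "real^'q^'p \<Rightarrow> real^'s^'r \<Rightarrow> real^('q \<times> 's)^('p \<times> 'r)" where
  "kronecker A B = (\<chi> i j. A $ fst i $ fst j * B $ snd i $ snd j)"

definition outer_square :: "real^'n \<Rightarrow> real^'n^'n" where
  "outer_square y = columnvector y ** (rowvector y :: real^'n^1)"

definition consistency_set ::
    "nat \<Rightarrow> (real^'n \<Rightarrow> real^'l) \<Rightarrow> real^'m^'n \<Rightarrow> real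
      \<Rightarrow> (nat \<Rightarrow> real^'n) \<Rightarrow> (nat \<Rightarrow> real^'n) \<Rightarrow> (nat \<Rightarrow> real^'m) \<Rightarrow> (real^'l^'n) set" where
  "consistency_set T \<phi> G \<epsilon> xd xs us =
     {F. \<forall>i\<in>{1..T}. infnorm (F *v \<phi> (xs i) + G *v us i - xd i) \<le> \<epsilon>}"

text \<open>The signs \<open>\<plusminus>\<close> are represented by a factor \<open>s\<close> ranging over \<open>{1, -1}\<close>.\<close>

definition data_matrix ::
    "(real^'n \<Rightarrow> real^'l) \<Rightarrow> (nat \<Rightarrow> real^'n) \<Rightarrow> nat \<Rightarrow> 'n \<Rightarrow> real \<Rightarrow> real^'n^'l" where
  "data_matrix \<phi> xs i k s = (\<chi> a j. if j = k then s * \<phi> (xs i) $ a else 0)"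

definition data_bound ::
    "real^'m^'n \<Rightarrow> real \<Rightarrow> (nat \<Rightarrow> real^'n) \<Rightarrow> (nat \<Rightarrow> real^'m) \<Rightarrow> nat \<Rightarrow> 'n \<Rightarrow> real \<Rightarrow> real" where
  "data_bound G \<epsilon> xd us i k s = \<epsilon> + s * (xd i - G *v us i) $ k"

text \<open>\<open>\<partial>\<^sub>G W(x) = 0\<close>: the derivative of \<open>W\<close> at \<open>x\<close> along every column of \<open>G\<close> vanishes.\<close>

definition dG_vanishes :: "real^'m^'n \<Rightarrow> (real^'n \<Rightarrow> real^'n^'n) \<Rightarrow> real^'n \<Rightarrow> bool" where
  "dG_vanishes G W x \<longleftrightarrow>
     (\<forall>i. (\<Sum>j\<in>UNIV. (G *v axis i 1) $ j *\<^sub>R partial_deriv j W x) = 0)"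

definition solves_robust_contraction ::
    "(real^'l^'n) set \<Rightarrow> (real^'n \<Rightarrow> real^'l) \<Rightarrow> real^'m^'n \<Rightarrow> real
      \<Rightarrow> (real^'n \<Rightarrow> real^'n^'n) \<Rightarrow> (real^'n \<Rightarrow> real) \<Rightarrow> bool" where
  "solves_robust_contraction P \<phi> G lam W \<rho> \<longleftrightarrow>
     (\<forall>x. dG_vanishes G W x) \<and>
     (\<forall>F\<in>P. \<forall>x.
        neg_def (- (\<Sum>j\<in>UNIV. (F *v \<phi> x) $ j *\<^sub>R partial_deriv j W x)
          + W x ** transpose (F ** jacobian \<phi> (at x))
          + (F ** jacobian \<phi> (at x)) ** W x
          + (2 * lam) *\<^sub>R W x - \<rho> x *\<^sub>R (G ** transpose G)))"

text \<open>In the second conjunct both summands are single-row matrices; the row index type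
  \<^typ>\<open>1 \<times> 1\<close> is the one of the Kronecker product of two row vectors.\<close>

definition multiplier_certificate ::
    "nat \<Rightarrow> (real^'n \<Rightarrow> real^'l) \<Rightarrow> real^'m^'n \<Rightarrow> real
      \<Rightarrow> (nat \<Rightarrow> real^'n) \<Rightarrow> (nat \<Rightarrow> real^'n) \<Rightarrow> (nat \<Rightarrow> real^'m) \<Rightarrow> real
      \<Rightarrow> (real^'n \<Rightarrow> real^'n^'n) \<Rightarrow> (real^'n \<Rightarrow> real)
      \<Rightarrow> (nat \<Rightarrow> 'n \<Rightarrow> real \<Rightarrow> real^'n \<Rightarrow> real^'n \<Rightarrow> real) \<Rightarrow> bool" where
  "multiplier_certificate T \<phi> G \<epsilon> xd xs us lam W \<rho> \<mu> \<longleftrightarrow>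
     (\<forall>x y. norm y = 1 \<longrightarrow>
        y \<bullet> ((- (2 * lam) *\<^sub>R W x + \<rho> x *\<^sub>R (G ** transpose G)) *v y)
          - (\<Sum>i\<in>{1..T}. \<Sum>k\<in>UNIV. \<Sum>s\<in>{1, -1}. \<mu> i k s x y * data_bound G \<epsilon> xd us i k s) > 0
        \<and>
        (rowvector (vec_cols
            (- 2 *\<^sub>R (jacobian \<phi> (at x) ** W x ** outer_square y)
              + (\<Sum>i\<in>{1..T}. \<Sum>k\<in>UNIV. \<Sum>s\<in>{1, -1}. \<mu> i k s x y *\<^sub>R data_matrix \<phi> xs i k s)))
           :: real^('n \<times> 'l)^(1 \<times> 1))
          + (\<Sum>j\<in>UNIV. trace (partial_deriv j W x ** outer_square y) *\<^sub>R
               kronecker (rowvector (axis j 1) :: real^'n^1) (rowvector (\<phi> x) :: real^'l^1)) = 0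
        \<and>
        dG_vanishes G W x
        \<and>
        (\<forall>i\<in>{1..T}. \<forall>k. \<forall>s\<in>{1, -1}. \<mu> i k s x y \<ge> 0) \<and> pos_def (W x))"

end

theory Submission
  imports Defs
begin

text \<open>
  Fix a point \<open>x\<close> and a unit vector \<open>y\<close>. The quadratic form at \<open>y\<close> of the matrix in the
  contraction inequality is an affine function of the unknown \<open>F\<close>: it equals \<open>N \<bullet> F - c\<close>, where
  \<open>N\<close> (called \<open>contraction_gradient\<close> below) collects the coefficients of \<open>F\<close> and
  \<open>c = y \<bullet> (- 2 \<lambda> W + \<rho> G G\<^sup>T) y\<close> (\<open>contraction_quadratic_form\<close>). The consistency set is the
  polyhedron of all \<open>F\<close> with \<open>a\<^sub>p \<bullet> F \<le> d\<^sub>p\<close>, where \<open>p\<close> runs over the triples of time, coordinate and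
  sign and \<open>a\<^sub>p\<close> is the transposed data matrix (\<open>mem_consistency_set_iff\<close>). Apart from
  \<open>\<partial>\<^sub>G W = 0\<close>, which is also condition (c), robust contraction therefore says exactly that
  \<open>N \<bullet> F < c\<close> on this polyhedron, for all \<open>x\<close> and \<open>y\<close>.

  Conditions (a) and (b) say in the same terms that \<open>\<Sum>\<^sub>p \<mu>\<^sub>p d\<^sub>p < c\<close> and \<open>\<Sum>\<^sub>p \<mu>\<^sub>p a\<^sub>p = N\<close>, so that a
  certificate is a dual proof of that bound: weak duality gives
  \<open>N \<bullet> F = \<Sum>\<^sub>p \<mu>\<^sub>p (a\<^sub>p \<bullet> F) \<le> \<Sum>\<^sub>p \<mu>\<^sub>p d\<^sub>p < c\<close>. Conversely, the affine Farkas lemma in strict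
  form (\<open>Farkas_affine_strict\<close>) yields such a proof for every strict bound valid on a non-empty
  polyhedron, and multipliers can be chosen separately at each pair \<open>(x, y)\<close>.
\<close>

section \<open>Linear inequalities\<close>

text \<open>A finitely generated cone is closed, so a vector outside of it is separated from it by a
  hyperplane through the origin.\<close>

lemma Farkas_cone:
  fixes a :: "'i \<Rightarrow> 'a::euclidean_space"
  assumes "finite I"
    and nonneg: "\<And>z. (\<And>i. i \<in> I \<Longrightarrow> 0 \<le> z \<bullet> a i) \<Longrightarrow> 0 \<le> z \<bullet> v"
  obtains \<mu> where "\<And>i. 0 \<le> \<mu> i" "(\<Sum>i\<in>I. \<mu> i *\<^sub>R a i) = v"
proof -
  let ?C = "convex_cone hull (a ` I)"
  let ?K = "{w. \<exists>\<mu>. (\<forall>i. 0 \<le> \<mu> i) \<and> (\<Sum>i\<in>I. \<mu> i *\<^sub>R a i) = w}"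
  have "v \<in> ?C"
  proof (rule ccontr)
    assume "v \<notin> ?C"
    then obtain z b where zv: "z \<bullet> v < b" and zC: "\<And>w. w \<in> ?C \<Longrightarrow> b < z \<bullet> w"
      using separating_hyperplane_closed_point[of ?C v] \<open>finite I\<close>
        closed_convex_cone_hull[of "a ` I"] convex_convex_cone_hull[of "a ` I"] by blast
    have "b < 0"
      using zC[OF convex_cone_hull_contains_0] by simp
    have "0 \<le> z \<bullet> a i" if "i \<in> I" for i
    proof (rule ccontr)
      assume neg: "\<not> 0 \<le> z \<bullet> a i"
      \<comment> \<open>The multiple of \<open>a i\<close> that lies on the hyperplane at level \<open>b\<close>, where the cone must not reach.\<close>
      have "(b / (z \<bullet> a i)) *\<^sub>R a i \<in> ?C"
        using that neg \<open>b < 0\<close>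
        by (intro convex_cone_hull_mul hull_inc) (auto simp: divide_nonpos_neg)
      then have "b < z \<bullet> ((b / (z \<bullet> a i)) *\<^sub>R a i)"
        by (rule zC)
      then show False
        using neg by simp
    qed
    then have "0 \<le> z \<bullet> v"
      by (rule nonneg)
    with zv \<open>b < 0\<close> show False by simp
  qed
  moreover have "?C \<subseteq> ?K"
  proof (rule hull_minimal)
    show "a ` I \<subseteq> ?K"
    proof clarsimp
      fix i assume "i \<in> I"
      then have "(\<Sum>j\<in>I. (if j = i then 1 else 0 :: real) *\<^sub>R a j) = a i"
        using \<open>finite I\<close> by (simp add: if_distrib[of "\<lambda>c. c *\<^sub>R _"] sum.delta cong: if_cong)
      then show "\<exists>\<mu>. (\<forall>j. 0 \<le> \<mu> j) \<and> (\<Sum>j\<in>I. \<mu> j *\<^sub>R a j) = a i"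
        by (intro exI[of _ "\<lambda>j. if j = i then 1 else 0"]) auto
    qed
    show "convex_cone ?K"
      unfolding convex_cone_iff
    proof (intro conjI ballI allI impI)
      show "0 \<in> ?K"
        by (auto intro!: exI[of _ "\<lambda>_. 0"])
    next
      fix x y assume "x \<in> ?K" "y \<in> ?K"
      then obtain \<mu> \<nu> where "\<forall>i. 0 \<le> \<mu> i" "\<forall>i. 0 \<le> \<nu> i"
        "(\<Sum>i\<in>I. \<mu> i *\<^sub>R a i) = x" "(\<Sum>i\<in>I. \<nu> i *\<^sub>R a i) = y" by auto
      then show "x + y \<in> ?K"
        by (auto intro!: exI[of _ "\<lambda>i. \<mu> i + \<nu> i"] simp: scaleR_add_left sum.distrib)
    next
      fix x and c :: real assume "x \<in> ?K" "0 \<le> c"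
      then obtain \<mu> where "\<forall>i. 0 \<le> \<mu> i" "(\<Sum>i\<in>I. \<mu> i *\<^sub>R a i) = x" by auto
      then show "c *\<^sub>R x \<in> ?K"
        using \<open>0 \<le> c\<close> by (auto intro!: exI[of _ "\<lambda>i. c * \<mu> i"] simp: scaleR_sum_right)
    qed
  qed
  ultimately have "v \<in> ?K" by blast
  then show thesis using that by blast
qed

text \<open>The system \<open>a i \<bullet> x \<le> d i\<close>, \<open>c \<le> v \<bullet> x\<close> has no solution. After homogenisation by an extra
  coordinate, this says that \<open>(0, -1)\<close> lies in the cone spanned by the vectors \<open>(a i, d i)\<close>,
  \<open>(- v, - c)\<close> and \<open>(0, 1)\<close>. The weight \<open>\<tau>\<close> of \<open>(- v, - c)\<close> cannot vanish because the constraints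
  alone are feasible; dividing by \<open>\<tau>\<close> gives the multipliers. The strict inequality comes from
  the entry \<open>-1\<close>.\<close>

lemma Farkas_affine_strict:
  fixes a :: "'i \<Rightarrow> 'a::euclidean_space" and d :: "'i \<Rightarrow> real"
  assumes "finite I"
    and feasible: "\<And>i. i \<in> I \<Longrightarrow> a i \<bullet> x0 \<le> d i"
    and less: "\<And>x. (\<And>i. i \<in> I \<Longrightarrow> a i \<bullet> x \<le> d i) \<Longrightarrow> v \<bullet> x < c"
  obtains \<mu> where "\<And>i. 0 \<le> \<mu> i" "(\<Sum>i\<in>I. \<mu> i *\<^sub>R a i) = v" "(\<Sum>i\<in>I. \<mu> i * d i) < c"
proof -
  define A where "A = case_sum (\<lambda>i. (a i, d i)) (\<lambda>b. if b then (- v, - c) else (0, 1))"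
  let ?J = "I <+> (UNIV :: bool set)"
  have nonneg: "0 \<le> z \<bullet> (0, -1)" if z: "\<And>j. j \<in> ?J \<Longrightarrow> 0 \<le> z \<bullet> A j" for z
  proof (rule ccontr)
    assume "\<not> 0 \<le> z \<bullet> (0, -1)"
    then obtain p w where zpw: "z = (p, w)" and "0 < w"
      by (cases z) (simp add: inner_Pair)
    \<comment> \<open>Dehomogenised point that would solve the unsolvable system.\<close>
    let ?x = "(- 1 / w) *\<^sub>R p"
    have "a i \<bullet> ?x \<le> d i" if "i \<in> I" for i
    proof -
      have "0 \<le> p \<bullet> a i + w * d i"
        using z[of "Inl i"] that by (simp add: A_def zpw inner_Pair InlI)
      then show ?thesis
        using \<open>0 < w\<close> by (simp add: inner_commute[of "a i"] field_simps)
    qed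
    then have "v \<bullet> ?x < c"
      by (rule less)
    moreover have "c \<le> v \<bullet> ?x"
    proof -
      have "0 \<le> - (p \<bullet> v) - w * c"
        using z[of "Inr True"] by (simp add: A_def zpw inner_Pair InrI)
      then show ?thesis
        using \<open>0 < w\<close> by (simp add: inner_commute[of v] field_simps)
    qed
    ultimately show False by simp
  qed
  have "finite ?J"
    using \<open>finite I\<close> by simp
  obtain \<nu> where nu: "\<And>j. 0 \<le> \<nu> j" and sumA: "(\<Sum>j\<in>?J. \<nu> j *\<^sub>R A j) = (0, -1)"
    by (rule Farkas_cone[OF \<open>finite ?J\<close> nonneg], assumption, rule that)
  define \<tau> where "\<tau> = \<nu> (Inr True)"
  define m where "m = (\<lambda>i. \<nu> (Inl i))"
  have "(\<Sum>j\<in>?J. \<nu> j *\<^sub>R A j)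
      = ((\<Sum>i\<in>I. m i *\<^sub>R a i) - \<tau> *\<^sub>R v, (\<Sum>i\<in>I. m i * d i) - \<tau> * c + \<nu> (Inr False))"
    using \<open>finite I\<close>
    by (simp add: sum.Plus A_def m_def \<tau>_def UNIV_bool prod_eq_iff fst_sum snd_sum)
  then have eqs: "(\<Sum>i\<in>I. m i *\<^sub>R a i) = \<tau> *\<^sub>R v"
      and le: "(\<Sum>i\<in>I. m i * d i) < \<tau> * c"
    using sumA nu[of "Inr False"] by auto
  have "0 \<le> \<tau>" and m: "\<And>i. 0 \<le> m i"
    using nu by (auto simp: \<tau>_def m_def)
  have "\<tau> \<noteq> 0"
  proof
    assume "\<tau> = 0"
    then have "0 = (\<Sum>i\<in>I. m i *\<^sub>R a i) \<bullet> x0"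
      using eqs by simp
    also have "\<dots> = (\<Sum>i\<in>I. m i * (a i \<bullet> x0))"
      by (simp add: inner_sum_left)
    also have "\<dots> \<le> (\<Sum>i\<in>I. m i * d i)"
      by (intro sum_mono mult_left_mono feasible m)
    finally show False
      using le \<open>\<tau> = 0\<close> by simp
  qed
  with \<open>0 \<le> \<tau>\<close> have "0 < \<tau>" by simp
  show thesis
  proof (rule that[of "\<lambda>i. m i / \<tau>"])
    show "0 \<le> m i / \<tau>" for i
      using m \<open>0 < \<tau>\<close> by simp
    have "(\<Sum>i\<in>I. (m i / \<tau>) *\<^sub>R a i) = (1 / \<tau>) *\<^sub>R (\<Sum>i\<in>I. m i *\<^sub>R a i)"
      by (simp add: scaleR_sum_right)
    then show "(\<Sum>i\<in>I. (m i / \<tau>) *\<^sub>R a i) = v"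
      using eqs \<open>0 < \<tau>\<close> by simp
    have "(\<Sum>i\<in>I. m i / \<tau> * d i) = (\<Sum>i\<in>I. m i * d i) / \<tau>"
      by (simp add: sum_divide_distrib)
    also have "\<dots> < c"
      using le \<open>0 < \<tau>\<close> by (simp add: pos_divide_less_eq mult.commute)
    finally show "(\<Sum>i\<in>I. m i / \<tau> * d i) < c" .
  qed
qed

section \<open>The data constraints as half-spaces\<close>

text \<open>The inner product of \<open>transpose \<Phi>\<close> and \<open>F\<close> is the trace of \<open>F ** \<Phi>\<close>. Transposed data matrices
  live in the same Euclidean space as the unknown \<open>F\<close>, which is the form the Farkas lemma needs.\<close>

lemma transpose_data_matrix_inner:
  "transpose (data_matrix \<phi> xs i k s) \<bullet> F = s * (F *v \<phi> (xs i)) $ k"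
proof -
  have "transpose (data_matrix \<phi> xs i k s) \<bullet> F
      = (\<Sum>j\<in>UNIV. \<Sum>a\<in>UNIV. (if j = k then s * \<phi> (xs i) $ a else 0) * F $ j $ a)"
    by (simp add: inner_vec_def transpose_def data_matrix_def)
  also have "\<dots> = (\<Sum>j\<in>UNIV. if j = k then \<Sum>a\<in>UNIV. s * \<phi> (xs i) $ a * F $ j $ a else 0)"
    by (intro sum.cong) auto
  also have "\<dots> = (\<Sum>a\<in>UNIV. s * \<phi> (xs i) $ a * F $ k $ a)"
    by simp
  also have "\<dots> = s * (F *v \<phi> (xs i)) $ k"
    by (simp add: matrix_vector_mult_def sum_distrib_left mult_ac)
  finally show ?thesis .
qed

lemma infnorm_le_iff_cart: "infnorm (z :: real^'n) \<le> e \<longleftrightarrow> (\<forall>k. \<bar>z $ k\<bar> \<le> e)"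
proof
  assume "infnorm z \<le> e"
  then show "\<forall>k. \<bar>z $ k\<bar> \<le> e"
    using component_le_infnorm_cart order_trans by blast
next
  assume "\<forall>k. \<bar>z $ k\<bar> \<le> e"
  then show "infnorm z \<le> e"
    unfolding infnorm_cart by (intro cSup_least) auto
qed

definition constraint_indices :: "nat \<Rightarrow> (nat \<times> 'n::finite \<times> real) set" where
  "constraint_indices T = {1..T} \<times> UNIV \<times> {1, -1}"

lemma finite_constraint_indices [simp]: "finite (constraint_indices T)"
  by (simp add: constraint_indices_def)

lemma sum_constraint_indices:
  fixes f :: "nat \<Rightarrow> 'n::finite \<Rightarrow> real \<Rightarrow> 'b::comm_monoid_add"
  shows "(\<Sum>(i, k, s)\<in>constraint_indices T. f i k s)
    = (\<Sum>i\<in>{1..T}. \<Sum>k\<in>UNIV. \<Sum>s\<in>{1, -1}. f i k s)"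
  by (simp only: constraint_indices_def sum.cartesian_product[symmetric])

lemma mem_consistency_set_iff:
  fixes \<phi> :: "real^'n \<Rightarrow> real^'l" and G :: "real^'m^'n"
  shows "F \<in> consistency_set T \<phi> G \<epsilon> xd xs us \<longleftrightarrow>
    (\<forall>(i, k, s)\<in>constraint_indices T.
       transpose (data_matrix \<phi> xs i k s) \<bullet> F \<le> data_bound G \<epsilon> xd us i k s)"
  unfolding consistency_set_def infnorm_le_iff_cart constraint_indices_def
    transpose_data_matrix_inner data_bound_def
  by (auto simp: abs_le_iff algebra_simps)

section \<open>The contraction condition as a linear functional of the unknown matrix\<close>

lemma matrix_mult_outer_square_nth:
  "(A ** outer_square y) $ a $ j = (A *v y) $ a * y $ j"
  by (simp add: outer_square_def matrix_matrix_mult_def matrix_vector_mult_def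
      columnvector_def rowvector_def sum_distrib_left mult_ac)

lemma trace_mult_outer_square: "trace (A ** outer_square y) = y \<bullet> (A *v y)"
  by (simp add: trace_def matrix_mult_outer_square_nth inner_vec_def mult.commute)

text \<open>The gradient with respect to \<open>F\<close> of the quadratic form at \<open>y\<close> of
  \<open>- dW/dt + W (F J)\<^sup>T + (F J) W\<close>, where \<open>J\<close> is the Jacobian of \<open>\<phi>\<close> at \<open>x\<close> and \<open>dW/dt\<close> is
  the derivative of \<open>W\<close> along \<open>F *v \<phi> x\<close>; that form is linear in \<open>F\<close>.\<close>

definition contraction_gradient ::
    "(real^'n \<Rightarrow> real^'l) \<Rightarrow> (real^'n \<Rightarrow> real^'n^'n) \<Rightarrow> real^'n \<Rightarrow> real^'n \<Rightarrow> real^'l^'n" where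
  "contraction_gradient \<phi> W x y =
     (\<chi> j a. 2 * (jacobian \<phi> (at x) *v (W x *v y)) $ a * y $ j
        - (y \<bullet> (partial_deriv j W x *v y)) * \<phi> x $ a)"

text \<open>Condition (b) states the equation between matrices entry by entry: the entry \<open>(j, a)\<close> of the
  vectorisation is the entry \<open>(a, j)\<close> of the matrix, and the Kronecker product of \<open>axis j 1\<close> with \<open>\<phi> x\<close>
  has the entries \<open>\<phi> x $ a\<close> in block \<open>j\<close> and \<open>0\<close> elsewhere.\<close>

lemma stationarity_iff:
  fixes \<phi> :: "real^'n \<Rightarrow> real^'l" and M :: "real^'n^'l"
  shows "(rowvector (vec_cols (- 2 *\<^sub>R (jacobian \<phi> (at x) ** W x ** outer_square y) + M))
           :: real^('n \<times> 'l)^(1 \<times> 1))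
         + (\<Sum>j\<in>UNIV. trace (partial_deriv j W x ** outer_square y) *\<^sub>R
               kronecker (rowvector (axis j 1) :: real^'n^1) (rowvector (\<phi> x) :: real^'l^1)) = 0
     \<longleftrightarrow> transpose M = contraction_gradient \<phi> W x y"
proof -
  have delta: "(\<Sum>j\<in>UNIV. c j * (axis j 1 $ p * b)) = c p * (b :: real)"
    for c and p :: 'n and b
  proof -
    have "(\<Sum>j\<in>UNIV. c j * (axis j 1 $ p * b)) = (\<Sum>j\<in>UNIV. if j = p then c j * b else 0)"
      by (intro sum.cong) (auto simp: axis_def)
    then show ?thesis by simp
  qed
  show ?thesis
    by (simp add: vec_eq_iff rowvector_def vec_cols_def kronecker_def transpose_def
        contraction_gradient_def trace_mult_outer_square matrix_mult_outer_square_nth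
        matrix_vector_mul_assoc[symmetric] delta)
       (auto simp: algebra_simps)
qed

lemma contraction_gradient_inner:
  fixes \<phi> :: "real^'n \<Rightarrow> real^'l"
  shows "contraction_gradient \<phi> W x y \<bullet> F
    = 2 * (y \<bullet> (F *v (jacobian \<phi> (at x) *v (W x *v y))))
      - (\<Sum>j\<in>UNIV. (F *v \<phi> x) $ j * (y \<bullet> (partial_deriv j W x *v y)))"
proof -
  have "(\<chi> j a. 2 * z $ a * y $ j - q j * p $ a) \<bullet> F
      = 2 * (y \<bullet> (F *v z)) - (\<Sum>j\<in>UNIV. (F *v p) $ j * q j)"
    for z p :: "real^'l" and q :: "'n \<Rightarrow> real"
  proof -
    have "(\<chi> j a. 2 * z $ a * y $ j - q j * p $ a) \<bullet> F
        = (\<Sum>j\<in>UNIV. \<Sum>a\<in>UNIV. 2 * (y $ j * (F $ j $ a * z $ a)) - F $ j $ a * p $ a * q j)"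
      by (simp add: inner_vec_def algebra_simps)
    then show ?thesis
      by (simp add: inner_vec_def matrix_vector_mult_def sum_subtractf sum_distrib_left
          sum_distrib_right)
  qed
  then show ?thesis
    unfolding contraction_gradient_def .
qed

lemma quadratic_form_sum:
  "y \<bullet> ((\<Sum>j\<in>S. c j *\<^sub>R A j) *v y) = (\<Sum>j\<in>S. c j * (y \<bullet> (A j *v y)))"
  for A :: "'j \<Rightarrow> real^'n^'n"
  by (induction S rule: infinite_finite_induct)
     (auto simp: matrix_vector_mult_add_rdistrib inner_add_right scaleR_matrix_vector_assoc[symmetric])

text \<open>As \<open>W x\<close> is symmetric, \<open>W (F J)\<^sup>T\<close> is the transpose of \<open>(F J) W\<close> and has the same quadratic
  form, whence the factor 2 in the gradient.\<close>

lemma contraction_quadratic_form: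
  fixes \<phi> :: "real^'n \<Rightarrow> real^'l" and G :: "real^'m^'n"
  assumes sym: "transpose (W x) = W x"
  shows "y \<bullet> ((- (\<Sum>j\<in>UNIV. (F *v \<phi> x) $ j *\<^sub>R partial_deriv j W x)
          + W x ** transpose (F ** jacobian \<phi> (at x))
          + (F ** jacobian \<phi> (at x)) ** W x
          + (2 * lam) *\<^sub>R W x - r *\<^sub>R (G ** transpose G)) *v y)
    = contraction_gradient \<phi> W x y \<bullet> F
      - y \<bullet> ((- (2 * lam) *\<^sub>R W x + r *\<^sub>R (G ** transpose G)) *v y)"
proof -
  let ?B = "(F ** jacobian \<phi> (at x)) ** W x"
  have "W x ** transpose (F ** jacobian \<phi> (at x)) = transpose ?B"
    by (simp add: matrix_transpose_mul sym)
  moreover have "y \<bullet> (transpose ?B *v y) = y \<bullet> (?B *v y)"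
    by (metis dot_lmul_matrix inner_commute transpose_matrix_vector)
  ultimately have flip: "y \<bullet> ((W x ** transpose (F ** jacobian \<phi> (at x))) *v y) = y \<bullet> (?B *v y)"
    by simp
  have B: "y \<bullet> (?B *v y) = y \<bullet> (F *v (jacobian \<phi> (at x) *v (W x *v y)))"
    by (simp add: matrix_vector_mul_assoc matrix_mul_assoc)
  have neg: "(- A) *v y = - (A *v y)" for A :: "real^'n^'n"
    using matrix_vector_mult_diff_rdistrib[of 0 A y] by simp
  show ?thesis
    unfolding matrix_vector_mult_add_rdistrib matrix_vector_mult_diff_rdistrib neg
      inner_add_right inner_diff_right inner_minus_right quadratic_form_sum flip
      contraction_gradient_inner B
    by (simp add: scaleR_matrix_vector_assoc[symmetric] neg)
qed

section \<open>Symmetry and reduction to unit vectors\<close>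

lemma C1_has_partial_deriv:
  assumes "C1 f"
  shows "((\<lambda>t. f (x + t *\<^sub>R axis j 1)) has_vector_derivative partial_deriv j f x) (at 0)"
proof -
  obtain D where D: "(f has_derivative D) (at x)"
    using assms unfolding C1_def by blast
  have "((\<lambda>t. x + t *\<^sub>R axis j 1) has_vector_derivative axis j 1) (at (0::real))"
    by (auto intro!: derivative_eq_intros)
  moreover have "(f has_derivative D) (at (x + 0 *\<^sub>R axis j 1))"
    using D by simp
  ultimately have "((f \<circ> (\<lambda>t. x + t *\<^sub>R axis j 1)) has_vector_derivative D (axis j 1)) (at 0)"
    using vector_derivative_diff_chain_within[of "\<lambda>t. x + t *\<^sub>R axis j 1" "axis j 1" 0 UNIV f D]
    by (simp add: has_derivative_at_withinI)
  then show ?thesis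
    unfolding partial_deriv_def o_def
    by (metis vector_derivative_at)
qed

text \<open>Negative definiteness includes symmetry, so the term coming from the derivative of \<open>W\<close> has to
  be symmetric. It is, because transposition is linear and continuous and thus commutes with
  differentiation.\<close>

lemma transpose_partial_deriv:
  fixes W :: "real^'n \<Rightarrow> real^'n^'n"
  assumes "C1 W" and sym: "\<And>x. transpose (W x) = W x"
  shows "transpose (partial_deriv j W x) = partial_deriv j W x"
proof -
  have "linear (transpose :: real^'n^'n \<Rightarrow> real^'n^'n)"
    by (auto intro!: linearI simp: transpose_def vec_eq_iff)
  then have "bounded_linear (transpose :: real^'n^'n \<Rightarrow> real^'n^'n)"
    by (simp add: linear_conv_bounded_linear)
  from bounded_linear.has_vector_derivative[OF this C1_has_partial_deriv[OF assms(1), of x j]]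
  have "((\<lambda>t. W (x + t *\<^sub>R axis j 1)) has_vector_derivative transpose (partial_deriv j W x)) (at 0)"
    by (simp add: sym)
  then show ?thesis
    using C1_has_partial_deriv[OF assms(1), of x j] vector_derivative_unique_at by blast
qed

lemma transpose_sum_scaleR:
  fixes A :: "'j \<Rightarrow> real^'n^'n"
  shows "transpose (\<Sum>j\<in>S. c j *\<^sub>R A j) = (\<Sum>j\<in>S. c j *\<^sub>R transpose (A j))"
  by (simp add: vec_eq_iff transpose_def)

text \<open>Certificates only speak about unit vectors; homogeneity of the quadratic form covers
  the others.\<close>

lemma neg_def_iff_unit:
  fixes A :: "real^'n^'n"
  shows "neg_def A \<longleftrightarrow> transpose A = A \<and> (\<forall>y. norm y = 1 \<longrightarrow> y \<bullet> (A *v y) < 0)"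
proof -
  have "v \<bullet> (A *v v) < 0" if unit: "\<And>y. norm y = 1 \<Longrightarrow> y \<bullet> (A *v y) < 0" and "v \<noteq> 0" for v
  proof -
    let ?y = "(1 / norm v) *\<^sub>R v"
    have "norm v *\<^sub>R ?y = v"
      using \<open>v \<noteq> 0\<close> by simp
    then have "v \<bullet> (A *v v) = (norm v *\<^sub>R ?y) \<bullet> (A *v (norm v *\<^sub>R ?y))"
      by (rule arg_cong[of _ _ "\<lambda>w. w \<bullet> (A *v w)", symmetric])
    also have "\<dots> = norm v * norm v * (?y \<bullet> (A *v ?y))"
      unfolding matrix_vector_mult_scaleR[of A "norm v" ?y] inner_scaleR_left[of "norm v" ?y]
        inner_scaleR_right[of ?y "norm v" "A *v ?y"] by (rule mult.assoc[symmetric])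
    also have "\<dots> < 0"
      using \<open>v \<noteq> 0\<close> by (intro mult_pos_neg unit) simp_all
    finally show ?thesis .
  qed
  moreover have "y \<noteq> 0" if "norm y = 1" for y :: "real^'n"
    using that by auto
  ultimately show ?thesis
    unfolding neg_def_def by blast
qed

section \<open>Robust contraction and its multiplier certificates\<close>

lemma solves_robust_contraction_iff:
  fixes \<phi> :: "real^'n \<Rightarrow> real^'l" and G :: "real^'m^'n"
  assumes "C1 W" and sym: "\<And>x. transpose (W x) = W x"
  shows "solves_robust_contraction P \<phi> G lam W \<rho> \<longleftrightarrow>
     (\<forall>x. dG_vanishes G W x) \<and>
     (\<forall>x y. norm y = 1 \<longrightarrow> (\<forall>F\<in>P. contraction_gradient \<phi> W x y \<bullet> F
        < y \<bullet> ((- (2 * lam) *\<^sub>R W x + \<rho> x *\<^sub>R (G ** transpose G)) *v y)))"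
proof -
  let ?M = "\<lambda>F x. - (\<Sum>j\<in>UNIV. (F *v \<phi> x) $ j *\<^sub>R partial_deriv j W x)
          + W x ** transpose (F ** jacobian \<phi> (at x))
          + (F ** jacobian \<phi> (at x)) ** W x
          + (2 * lam) *\<^sub>R W x - \<rho> x *\<^sub>R (G ** transpose G)"
  have add: "transpose (A + B) = transpose A + transpose B"
    and diff: "transpose (A - B) = transpose A - transpose B"
    and minus: "transpose (- A) = - transpose A" for A B :: "real^'n^'n"
    by (simp_all add: vec_eq_iff transpose_def)
  have "transpose (?M F x) = ?M F x" for F x
    unfolding add diff minus transpose_sum_scaleR transpose_partial_deriv[OF assms] transpose_scalar
    by (simp add: matrix_transpose_mul sym)
  then show ?thesis
    unfolding solves_robust_contraction_def neg_def_iff_unit 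
      contraction_quadratic_form[where W = W, OF sym] diff_less_0_iff_less
    by blast
qed

lemma multiplier_certificate_iff:
  fixes \<phi> :: "real^'n \<Rightarrow> real^'l" and G :: "real^'m^'n"
  shows "multiplier_certificate T \<phi> G \<epsilon> xd xs us lam W \<rho> \<mu> \<longleftrightarrow>
    (\<forall>x y. norm y = 1 \<longrightarrow>
       (\<Sum>(i, k, s)\<in>constraint_indices T. \<mu> i k s x y * data_bound G \<epsilon> xd us i k s)
         < y \<bullet> ((- (2 * lam) *\<^sub>R W x + \<rho> x *\<^sub>R (G ** transpose G)) *v y) \<and>
       (\<Sum>(i, k, s)\<in>constraint_indices T. \<mu> i k s x y *\<^sub>R transpose (data_matrix \<phi> xs i k s))
         = contraction_gradient \<phi> W x y \<and>
       dG_vanishes G W x \<and>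
       (\<forall>(i, k, s)\<in>constraint_indices T. 0 \<le> \<mu> i k s x y) \<and> pos_def (W x))"
proof -
  have transp: "transpose (\<Sum>i\<in>{1..T}. \<Sum>k\<in>UNIV. \<Sum>s\<in>{1, -1}. m i k s *\<^sub>R data_matrix \<phi> xs i k s)
      = (\<Sum>i\<in>{1..T}. \<Sum>k\<in>UNIV. \<Sum>s\<in>{1, -1}. m i k s *\<^sub>R transpose (data_matrix \<phi> xs i k s))"
    for m :: "nat \<Rightarrow> 'n \<Rightarrow> real \<Rightarrow> real"
    by (simp add: vec_eq_iff transpose_def)
  have nonneg: "(\<forall>(i, k, s)\<in>constraint_indices T. 0 \<le> m i k s)
      \<longleftrightarrow> (\<forall>i\<in>{1..T}. \<forall>k. \<forall>s\<in>{1, -1}. 0 \<le> m i k s)"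
    for m :: "nat \<Rightarrow> 'n \<Rightarrow> real \<Rightarrow> real"
    by (auto simp: constraint_indices_def)
  show ?thesis
    unfolding multiplier_certificate_def stationarity_iff transp sum_constraint_indices nonneg
      diff_gt_0_iff_gt ..
qed

text \<open>Weak duality: pair the identity for \<open>contraction_gradient\<close> with a consistent \<open>F\<close> and bound each
  term by its constraint.\<close>

theorem certificate_imp_robust_contraction:
  fixes \<phi> :: "real^'n \<Rightarrow> real^'l" and G :: "real^'m^'n"
  assumes "C1 W" and "\<And>x. transpose (W x) = W x"
    and cert: "multiplier_certificate T \<phi> G \<epsilon> xd xs us lam W \<rho> \<mu>"
  shows "solves_robust_contraction (consistency_set T \<phi> G \<epsilon> xd xs us) \<phi> G lam W \<rho>"
  unfolding solves_robust_contraction_iff[OF assms(1,2)]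
proof (intro conjI allI impI ballI)
  fix x
  \<comment> \<open>A certificate asserts condition (c) only together with some unit vector.\<close>
  obtain y :: "real^'n" where "norm y = 1"
    using vector_choose_size[of 1] by auto
  then show "dG_vanishes G W x"
    using cert unfolding multiplier_certificate_iff by blast
next
  fix x y :: "real^'n" and F
  assume "norm y = 1" and F: "F \<in> consistency_set T \<phi> G \<epsilon> xd xs us"
  let ?I = "constraint_indices T :: (nat \<times> 'n \<times> real) set"
  let ?c = "y \<bullet> ((- (2 * lam) *\<^sub>R W x + \<rho> x *\<^sub>R (G ** transpose G)) *v y)"
  note c = cert[unfolded multiplier_certificate_iff, rule_format, OF \<open>norm y = 1\<close>, of x]
  have "contraction_gradient \<phi> W x y \<bullet> F
      = (\<Sum>(i, k, s)\<in>?I. \<mu> i k s x y * (transpose (data_matrix \<phi> xs i k s) \<bullet> F))"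
    using c[THEN conjunct2, THEN conjunct1, symmetric]
    by (simp add: inner_sum_left case_prod_unfold)
  also have "\<dots> \<le> (\<Sum>(i, k, s)\<in>?I. \<mu> i k s x y * data_bound G \<epsilon> xd us i k s)"
    using c F unfolding mem_consistency_set_iff
    by (intro sum_mono) (fastforce intro: mult_left_mono)
  also have "\<dots> < ?c"
    using c by blast
  finally show "contraction_gradient \<phi> W x y \<bullet> F < ?c" .
qed

text \<open>Strong duality, applied separately at every \<open>x\<close> and every unit vector \<open>y\<close>. A consistent
  matrix is what makes the constraints feasible in \<open>Farkas_affine_strict\<close>.\<close>

theorem robust_contraction_imp_certificate:
  fixes \<phi> :: "real^'n \<Rightarrow> real^'l" and G :: "real^'m^'n"
  assumes "C1 W" and pos: "\<And>x. pos_def (W x)"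
    and nonempty: "consistency_set T \<phi> G \<epsilon> xd xs us \<noteq> {}"
    and solves: "solves_robust_contraction (consistency_set T \<phi> G \<epsilon> xd xs us) \<phi> G lam W \<rho>"
  obtains \<mu> where "multiplier_certificate T \<phi> G \<epsilon> xd xs us lam W \<rho> \<mu>"
proof -
  let ?I = "constraint_indices T :: (nat \<times> 'n \<times> real) set"
  let ?a = "\<lambda>(i, k, s). transpose (data_matrix \<phi> xs i k s)"
  let ?d = "\<lambda>(i, k, s). data_bound G \<epsilon> xd us i k s"
  let ?c = "\<lambda>x y. y \<bullet> ((- (2 * lam) *\<^sub>R W x + \<rho> x *\<^sub>R (G ** transpose G)) *v y)"
  have mem: "F \<in> consistency_set T \<phi> G \<epsilon> xd xs us \<longleftrightarrow> (\<forall>p\<in>?I. ?a p \<bullet> F \<le> ?d p)" for F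
    unfolding mem_consistency_set_iff by (simp add: case_prod_unfold)
  have sym: "\<And>x. transpose (W x) = W x"
    using pos by (simp add: pos_def_def)
  note solves' = solves[unfolded solves_robust_contraction_iff[OF \<open>C1 W\<close> sym]]
  obtain F0 where F0: "\<And>p. p \<in> ?I \<Longrightarrow> ?a p \<bullet> F0 \<le> ?d p"
    using nonempty mem by blast
  let ?Q = "\<lambda>x y m. (\<forall>p. 0 \<le> m p)
      \<and> (\<Sum>p\<in>?I. m p *\<^sub>R ?a p) = contraction_gradient \<phi> W x y \<and> (\<Sum>p\<in>?I. m p * ?d p) < ?c x y"
  have ex: "\<exists>m. ?Q x y m" if "norm y = 1" for x y
  proof -
    have bound: "contraction_gradient \<phi> W x y \<bullet> F < ?c x y"
      if "\<And>p. p \<in> ?I \<Longrightarrow> ?a p \<bullet> F \<le> ?d p" for F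
    proof -
      have "F \<in> consistency_set T \<phi> G \<epsilon> xd xs us"
        unfolding mem by (intro ballI that)
      then show ?thesis
        using solves' \<open>norm y = 1\<close> by blast
    qed
    show ?thesis
    proof (rule Farkas_affine_strict[where a = ?a and d = ?d, OF finite_constraint_indices F0 bound])
      fix m
      assume "\<And>p. 0 \<le> m p" "(\<Sum>p\<in>?I. m p *\<^sub>R ?a p) = contraction_gradient \<phi> W x y"
        "(\<Sum>p\<in>?I. m p * ?d p) < ?c x y"
      then show ?thesis by (intro exI[of _ m] conjI allI)
    qed
  qed
  define m where "m = (\<lambda>x y. SOME m. ?Q x y m)"
  have m: "?Q x y (m x y)" if "norm y = 1" for x y
    using someI_ex[OF ex[OF that]] unfolding m_def .
  have "multiplier_certificate T \<phi> G \<epsilon> xd xs us lam W \<rho> (\<lambda>i k s x y. m x y (i, k, s))"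
    unfolding multiplier_certificate_iff
    using m solves' pos by (auto simp: case_prod_unfold)
  then show thesis by (rule that)
qed

theorem theorem1:
  fixes T :: nat
    and \<phi> :: "real^'n \<Rightarrow> real^'l"
    and G :: "real^'m^'n"
    and \<epsilon> lam :: real
    and xd xs :: "nat \<Rightarrow> real^'n"
    and us :: "nat \<Rightarrow> real^'m"
    and W :: "real^'n \<Rightarrow> real^'n^'n"
    and \<rho> :: "real^'n \<Rightarrow> real"
  assumes "T \<ge> 1"
    and "\<And>a. is_monomial (\<lambda>x. \<phi> x $ a)"
    and "\<epsilon> \<ge> 0"
    and "lam > 0"
    and "C1 W"
    and "\<And>x. pos_def (W x)"
  shows "((\<exists>\<mu>. multiplier_certificate T \<phi> G \<epsilon> xd xs us lam W \<rho> \<mu>) \<longrightarrow>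
            solves_robust_contraction (consistency_set T \<phi> G \<epsilon> xd xs us) \<phi> G lam W \<rho>)
       \<and> (interior (consistency_set T \<phi> G \<epsilon> xd xs us) \<noteq> {} \<longrightarrow>
            solves_robust_contraction (consistency_set T \<phi> G \<epsilon> xd xs us) \<phi> G lam W \<rho> \<longrightarrow>
            (\<exists>\<mu>. multiplier_certificate T \<phi> G \<epsilon> xd xs us lam W \<rho> \<mu>))"
proof (intro conjI impI)
  assume "\<exists>\<mu>. multiplier_certificate T \<phi> G \<epsilon> xd xs us lam W \<rho> \<mu>"
  then show "solves_robust_contraction (consistency_set T \<phi> G \<epsilon> xd xs us) \<phi> G lam W \<rho>"
    using certificate_imp_robust_contraction assms(5,6) by (metis pos_def_def)
next
  assume "interior (consistency_set T \<phi> G \<epsilon> xd xs us) \<noteq> {}"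
    and "solves_robust_contraction (consistency_set T \<phi> G \<epsilon> xd xs us) \<phi> G lam W \<rho>"
  moreover from this(1) have "consistency_set T \<phi> G \<epsilon> xd xs us \<noteq> {}"
    by auto
  ultimately show "\<exists>\<mu>. multiplier_certificate T \<phi> G \<epsilon> xd xs us lam W \<rho> \<mu>"
    using robust_contraction_imp_certificate[OF assms(5,6)] by metis
qed

end
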